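(* Let $m$ be a fixed positive integer, let $n$ be a positive integer, and let $\sigma$ be any permutation of $\{1,\dots,n\}$ of cycle type $\mathbf{a}=(a_1,\dots,a_n)$, i.e. for every $\ell\in\{1,\dots,n\}$, $\sigma$ has exactly $a_\ell$ cycles of length $\ell$. Let $r^{(m)}(\mathbf{a})$ be the number of $m$th roots of $\sigma$. Then $$r^{(m)}(\mathbf{a})=\prod_{\substack{\ell\ge 1\\ a_\ell\neq 0}} a_\ell!\left(\sum_{\varepsilon\in\mathcal{E}_m(\ell,a_\ell)}\ \prod_{i=1}^{k}\frac{\ell^{(g_i-1)\varepsilon_i}}{g_i^{\varepsilon_i}\,\varepsilon_i!}\right),$$ where, for each $\ell$, $k=|G_m(\ell,a_\ell)|$ and $(g_1,\dots,g_k)$ is the associate vector of $G_m(\ell,a_\ell)$.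
   Context: $\mathbb{N}$ denotes the positive integers and $\mathbb{N}_0$ the non-negative integers. $S_n$ is the group of permutations of $\{1,\dots,n\}$; an $m$th root of $\sigma\in S_n$ is a permutation $\tau\in S_n$ with $\tau^m=\sigma$. Fixed points count as cycles of length 1. For $m,\ell\in\mathbb{N}$ and $a\in\mathbb{N}_0$ define $G_m(\ell,a)=\{g\in\mathbb{N}: g\le a,\ \gcd(g\ell,m)=g\}$, a finite set. If $G_m(\ell,a)=\{g_1,\dots,g_k\}$ with $g_1<g_2<\cdots<g_k$, the vector $\mathbf{g}=(g_1,\dots,g_k)$ is called the associate vector of $G_m(\ell,a)$. When $k=|G_m(\ell,a)|\ge 1$, define $\mathcal{E}_m(\ell,a)=\{\varepsilon=(\varepsilon_1,\dots,\varepsilon_k)\in\mathbb{N}_0^k: g_1\varepsilon_1+\cdots+g_k\varepsilon_k=a\}$, which is empty if the equation $g_1x_1+\cdots+g_kx_k=a$ has no non-negative integer solutions. If $a\ge 1$ and $G_m(\ell,a)$ is empty, then $\mathcal{E}_m(\ell,a)=\emptyset$. A sum over an empty index set equals $0$. *)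

theory Defs
  imports Complex_Main "HOL-Combinatorics.Orbits"
begin

definition mth_roots :: "nat \<Rightarrow> nat \<Rightarrow> (nat \<Rightarrow> nat) \<Rightarrow> (nat \<Rightarrow> nat) set" where
  "mth_roots m n \<sigma> = {\<tau>. \<tau> permutes {1..n} \<and> \<tau> ^^ m = \<sigma>}"

(* A cycle is represented by its underlying set, an orbit; fixed points are orbits of size 1. *)
definition cycles_of_length :: "nat \<Rightarrow> (nat \<Rightarrow> nat) \<Rightarrow> nat \<Rightarrow> nat set set" where
  "cycles_of_length n \<sigma> l = {C \<in> orbit \<sigma> ` {1..n}. card C = l}"

(* Only the values a 1, ..., a n are relevant. *)
definition has_cycle_type :: "nat \<Rightarrow> (nat \<Rightarrow> nat) \<Rightarrow> (nat \<Rightarrow> nat) \<Rightarrow> bool" where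
  "has_cycle_type n \<sigma> a \<longleftrightarrow> (\<forall>l\<in>{1..n}. card (cycles_of_length n \<sigma> l) = a l)"

definition G :: "nat \<Rightarrow> nat \<Rightarrow> nat \<Rightarrow> nat set" where
  "G m l a = {g. 1 \<le> g \<and> g \<le> a \<and> gcd (g * l) m = g}"

definition assoc_vec :: "nat \<Rightarrow> nat \<Rightarrow> nat \<Rightarrow> nat list" where
  "assoc_vec m l a = sorted_list_of_set (G m l a)"

(* Vectors are lists, indexed from 0. If G m l a is empty and a \<ge> 1, the only candidate is
   the empty vector, whose sum is 0, so \<E> m l a is empty. The case a = 0 is never used. *)
definition \<E> :: "nat \<Rightarrow> nat \<Rightarrow> nat \<Rightarrow> nat list set" where
  "\<E> m l a = {\<epsilon>. length \<epsilon> = card (G m l a) \<and>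
     (\<Sum>i<card (G m l a). assoc_vec m l a ! i * \<epsilon> ! i) = a}"

lemma finite_G: "finite (G m l a)"
  by (rule finite_subset[of _ "{..a}"]) (auto simp: G_def)

lemma assoc_vec_props:
  "length (assoc_vec m l a) = card (G m l a)" "set (assoc_vec m l a) = G m l a"
  "sorted_wrt (<) (assoc_vec m l a)"
  by (simp_all add: assoc_vec_def finite_G)

lemma \<E>_empty: "a \<ge> 1 \<Longrightarrow> G m l a = {} \<Longrightarrow> \<E> m l a = {}"
  by (simp add: \<E>_def)

lemma finite_\<E>: "finite (\<E> m l a)"
proof (rule finite_subset)
  show "\<E> m l a \<subseteq> {xs. set xs \<subseteq> {..a} \<and> length xs = card (G m l a)}"
  proof
    fix \<epsilon> assume e: "\<epsilon> \<in> \<E> m l a"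
    then have len: "length \<epsilon> = card (G m l a)"
      and sum: "(\<Sum>i<card (G m l a). assoc_vec m l a ! i * \<epsilon> ! i) = a"
      by (auto simp: \<E>_def)
    show "\<epsilon> \<in> {xs. set xs \<subseteq> {..a} \<and> length xs = card (G m l a)}"
    proof (intro CollectI conjI subsetI len)
      fix y assume "y \<in> set \<epsilon>"
      then obtain i where i: "i < card (G m l a)" "y = \<epsilon> ! i"
        by (metis in_set_conv_nth len)
      then have "assoc_vec m l a ! i \<in> G m l a"
        by (metis assoc_vec_props(1,2) nth_mem)
      then have "y \<le> assoc_vec m l a ! i * \<epsilon> ! i"
        using i by (simp add: G_def)
      also have "\<dots> \<le> (\<Sum>i<card (G m l a). assoc_vec m l a ! i * \<epsilon> ! i)"
        by (rule member_le_sum) (use i in auto)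
      finally show "y \<in> {..a}" using sum by simp
    qed
  qed
  show "finite {xs. set xs \<subseteq> {..a} \<and> length xs = card (G m l a)}"
    by (rule finite_lists_length_eq) simp
qed

lemma finite_mth_roots: "finite (mth_roots m n \<sigma>)"
  by (rule finite_subset[OF _ finite_permutations[of "{1..n}"]]) (auto simp: mth_roots_def)

end

theory Submission
  imports Defs "HOL-Number_Theory.Cong"
begin

text \<open>
  An \<open>m\<close>th root \<open>\<tau>\<close> of \<open>\<sigma>\<close> commutes with \<open>\<sigma>\<close>, so it preserves the length of the \<open>\<sigma>\<close>-cycle through a
  point; hence the roots can be counted separately on the points in cycles of each length \<open>l\<close>.
  If there are \<open>a\<close> such cycles, fix a point \<open>x\<close>. Its \<open>\<tau>\<close>-cycle is the union of \<open>g\<close> cycles of \<open>\<sigma>\<close>, where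
  \<open>gcd (g * l) m = g\<close>, and it is determined by \<open>x, \<tau> x, \<dots>, \<tau> ^ (g - 1) x\<close>, which can be any points in
  distinct cycles of \<open>\<sigma>\<close>. There are \<open>(a - 1) \<dots> (a - g + 1) * l ^ (g - 1)\<close> possibilities, so the number
  \<open>N a\<close> of roots satisfies
  \<open>N a = (\<Sum>g. l ^ (g - 1) * (a - 1)! / (a - g)! * N (a - g))\<close>.
  After division by \<open>a!\<close> this is the recursion for the coefficients of
  \<open>exp (\<Sum>g. l ^ (g - 1) / g * z ^ g)\<close>.
\<close>

section \<open>Orbits and restrictions\<close>

text \<open>\<open>funpow_dist1 f x x\<close> is the first return time to \<open>x\<close>. The
  powers below it give distinct points and exhaust the orbit, so it equals the cardinality, and
  exponents may be reduced modulo it.\<close>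

lemma funpow_eq_iff_cong_card_orbit:
  assumes "permutation f"
  shows "(f ^^ i) x = (f ^^ j) x \<longleftrightarrow> [i = j] (mod card (orbit f x))"
proof -
  let ?L = "funpow_dist1 f x x"
  have self: "x \<in> orbit f x"
    using assms by (rule permutation_self_in_orbit)
  have inj: "inj_on (\<lambda>n. (f ^^ n) x) {0..<?L}"
    using self by (rule inj_on_funpow_dist1)
  have card: "card (orbit f x) = ?L"
    by (subst orbit_conv_funpow_dist1[OF self]) (simp add: card_image[OF inj])
  have reduce: "(f ^^ (k mod ?L)) x = (f ^^ k) x" for k
    by (rule funpow_mod_eq) (rule funpow_dist1_prop[OF self])
  have "(f ^^ i) x = (f ^^ j) x \<longleftrightarrow> (f ^^ (i mod ?L)) x = (f ^^ (j mod ?L)) x"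
    by (simp only: reduce)
  also have "\<dots> \<longleftrightarrow> i mod ?L = j mod ?L"
    by (rule inj_on_eq_iff[OF inj]) simp_all
  finally show ?thesis
    by (simp add: card cong_def)
qed

lemma card_orbit_pos:
  assumes "permutation f"
  shows "0 < card (orbit f x)"
  using finite_orbit[OF permutation_self_in_orbit[OF assms]] orbit_nonempty[of f x]
  by (simp add: card_gt_0_iff)

lemma funpow_in_orbit_self:
  assumes "permutation f"
  shows "(f ^^ k) x \<in> orbit f x"
  using assms by (auto simp: orbit_altdef_permutation)

lemma orbit_eq_if_in_orbit:
  assumes "permutation f" "y \<in> orbit f x"
  shows "orbit f y = orbit f x"
  using orbit_cyclic_eq3[OF cyclic_on_orbit'[OF assms(1)] assms(2)] .

lemma funpow_in_invariant:
  assumes "f ` S \<subseteq> S" "x \<in> S"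
  shows "(f ^^ k) x \<in> S"
  using assms by (induction k) auto

lemma orbit_subset_invariant:
  assumes "f ` S \<subseteq> S" "x \<in> S"
  shows "orbit f x \<subseteq> S"
  using funpow_in_invariant[OF assms] by (auto simp: orbit_altdef)

lemma image_orbit_permutation:
  assumes "permutation f"
  shows "f ` orbit f x = orbit f x"
proof
  show "f ` orbit f x \<subseteq> orbit f x"
    by (auto intro: orbit.step)
  show "orbit f x \<subseteq> f ` orbit f x"
  proof
    fix y assume "y \<in> orbit f x"
    then show "y \<in> f ` orbit f x"
      using permutation_self_in_orbit[OF assms] by cases auto
  qed
qed

lemma image_invariant_diff:
  assumes "permutation f" "f ` S = S" "f ` U = U"
  shows "f ` (S - U) = S - U"
  using assms by (simp add: image_set_diff permutation_bijective bij_is_inj)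

text \<open>The root equation is required only on \<open>S\<close>, with \<sigma> itself left
  unrestricted. One \<sigma> thus serves all invariant pieces, and "permutes" makes each root on a
  piece the identity elsewhere, hence unique as a function.\<close>

definition roots_on :: "nat \<Rightarrow> ('a \<Rightarrow> 'a) \<Rightarrow> 'a set \<Rightarrow> ('a \<Rightarrow> 'a) set" where
  "roots_on m \<sigma> S = {\<tau>. \<tau> permutes S \<and> (\<forall>x\<in>S. (\<tau> ^^ m) x = \<sigma> x)}"

lemma finite_roots_on: "finite S \<Longrightarrow> finite (roots_on m \<sigma> S)"
  by (rule finite_subset[OF _ finite_permutations[of S]]) (auto simp: roots_on_def)

lemma roots_on_empty: "roots_on m \<sigma> {} = {id}"
  by (auto simp: roots_on_def permutes_empty)

text \<open>A function commutes with its own powers. As \<sigma> is the power only on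
  \<open>S\<close>, the root equation is needed at \<open>x\<close> and also at
  \<open>\<tau> x\<close>, which stays in \<open>S\<close>.\<close>

lemma roots_on_commute:
  assumes "\<tau> \<in> roots_on m \<sigma> S" "x \<in> S"
  shows "\<tau> (\<sigma> x) = \<sigma> (\<tau> x)"
proof -
  have "\<tau> x \<in> S"
    using assms permutes_in_image[of \<tau> S x] by (simp add: roots_on_def)
  then have "(\<tau> ^^ m) (\<tau> x) = \<sigma> (\<tau> x)" "(\<tau> ^^ m) x = \<sigma> x"
    using assms by (simp_all add: roots_on_def)
  then show ?thesis
    using funpow_swap1[of \<tau> m x] by simp
qed

lemma funpow_cong_invariant:
  assumes "\<And>x. x \<in> S \<Longrightarrow> f x = g x" "g ` S \<subseteq> S" "x \<in> S"
  shows "(f ^^ k) x = (g ^^ k) x"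
proof (induction k)
  case (Suc k)
  then show ?case
    using funpow_in_invariant[OF assms(2,3), of k] assms(1) by simp
qed simp

section \<open>Gluing roots on disjoint sets\<close>

definition glue :: "'a set \<Rightarrow> ('a \<Rightarrow> 'a) \<Rightarrow> ('a \<Rightarrow> 'a) \<Rightarrow> 'a \<Rightarrow> 'a" where
  "glue A \<alpha> \<beta> x = (if x \<in> A then \<alpha> x else \<beta> x)"

lemma glue_permutes:
  assumes "\<alpha> permutes A" "\<beta> permutes B" "A \<inter> B = {}"
  shows "glue A \<alpha> \<beta> permutes (A \<union> B)"
proof -
  \<comment> \<open>The sets are disjoint, so \<beta> fixes everything in \<open>A\<close> and
    \<alpha> everything outside it. The case distinction is therefore a composition.\<close>
  have "glue A \<alpha> \<beta> = \<beta> \<circ> \<alpha>"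
  proof
    fix x
    show "glue A \<alpha> \<beta> x = (\<beta> \<circ> \<alpha>) x"
    proof (cases "x \<in> A")
      case True
      then have "\<alpha> x \<notin> B"
        using assms(3) permutes_in_image[OF assms(1), of x] by auto
      with True show ?thesis
        by (simp add: glue_def permutes_not_in[OF assms(2)])
    qed (simp add: glue_def permutes_not_in[OF assms(1)])
  qed
  then show ?thesis
    using permutes_subset[OF assms(1), of "A \<union> B"] permutes_subset[OF assms(2), of "A \<union> B"]
    by (simp add: permutes_compose)
qed

lemma glue_roots:
  assumes "\<alpha> \<in> roots_on m \<sigma> A" "\<beta> \<in> roots_on m \<sigma> B" "A \<inter> B = {}"
  shows "glue A \<alpha> \<beta> \<in> roots_on m \<sigma> (A \<union> B)"
proof -
  have \<alpha>: "\<alpha> permutes A" and \<beta>: "\<beta> permutes B"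
    using assms by (auto simp: roots_on_def)
  have "(glue A \<alpha> \<beta> ^^ m) x = (\<alpha> ^^ m) x" if "x \<in> A" for x
    using that \<alpha> by (intro funpow_cong_invariant[of A]) (auto simp: glue_def permutes_image)
  moreover have "(glue A \<alpha> \<beta> ^^ m) x = (\<beta> ^^ m) x" if "x \<in> B" for x
    using that \<beta> assms(3)
    by (intro funpow_cong_invariant[of B]) (auto simp: glue_def permutes_image)
  ultimately show ?thesis
    using assms glue_permutes[OF \<alpha> \<beta> assms(3)] by (auto simp: roots_on_def)
qed

lemma perm_restrict_roots:
  assumes "\<tau> \<in> roots_on m \<sigma> S" "A \<subseteq> S" "\<tau> ` A = A"
  shows "perm_restrict \<tau> A \<in> roots_on m \<sigma> A"
proof -
  have inj: "inj \<tau>"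
    using assms(1) by (auto simp: roots_on_def permutes_inj)
  have "bij_betw \<tau> A A"
    using assms(3) inj_on_subset[OF inj, of A] by (simp add: bij_betw_def)
  then have "bij_betw (perm_restrict \<tau> A) A A"
    by (rule bij_betw_cong[THEN iffD1, rotated]) (simp add: perm_restrict_simps)
  then have "perm_restrict \<tau> A permutes A"
    by (rule bij_imp_permutes) (simp add: perm_restrict_simps)
  moreover have "(perm_restrict \<tau> A ^^ m) x = (\<tau> ^^ m) x" if "x \<in> A" for x
    using that assms(3) by (intro funpow_cong_invariant[of A]) (auto simp: perm_restrict_simps)
  ultimately show ?thesis
    using assms by (auto simp: roots_on_def)
qed

text \<open>The inverse of gluing is restriction to both parts. Gluing reaches exactly the roots
  that respect the splitting, hence the condition on the image of \<open>A\<close>.\<close>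

lemma bij_betw_glue_roots:
  assumes "A \<inter> B = {}"
  shows "bij_betw (\<lambda>(\<alpha>, \<beta>). glue A \<alpha> \<beta>) (roots_on m \<sigma> A \<times> roots_on m \<sigma> B)
           {\<tau> \<in> roots_on m \<sigma> (A \<union> B). \<tau> ` A = A}"
proof (rule bij_betwI[where g = "\<lambda>\<tau>. (perm_restrict \<tau> A, perm_restrict \<tau> B)"])
  show "(\<lambda>(\<alpha>, \<beta>). glue A \<alpha> \<beta>) \<in> roots_on m \<sigma> A \<times> roots_on m \<sigma> B
          \<rightarrow> {\<tau> \<in> roots_on m \<sigma> (A \<union> B). \<tau> ` A = A}"
  proof clarsimp
    fix \<alpha> \<beta> assume *: "\<alpha> \<in> roots_on m \<sigma> A" "\<beta> \<in> roots_on m \<sigma> B"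
    then have "\<alpha> ` A = A"
      by (auto simp: roots_on_def permutes_image)
    then show "glue A \<alpha> \<beta> \<in> roots_on m \<sigma> (A \<union> B) \<and> glue A \<alpha> \<beta> ` A = A"
      using glue_roots[OF * assms] by (simp add: glue_def cong: image_cong_simp)
  qed
  show "(\<lambda>\<tau>. (perm_restrict \<tau> A, perm_restrict \<tau> B))
          \<in> {\<tau> \<in> roots_on m \<sigma> (A \<union> B). \<tau> ` A = A} \<rightarrow> roots_on m \<sigma> A \<times> roots_on m \<sigma> B"
  proof clarsimp
    fix \<tau> assume \<tau>: "\<tau> \<in> roots_on m \<sigma> (A \<union> B)" "\<tau> ` A = A"
    \<comment> \<open>By injectivity, a root that maps \<open>A\<close> onto itself also maps the
      complement \<open>B\<close> onto itself.\<close>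
    have "\<tau> ` (A \<union> B - A) = \<tau> ` (A \<union> B) - \<tau> ` A"
      using \<tau> by (intro image_set_diff) (auto simp: roots_on_def permutes_inj)
    then have "\<tau> ` (A \<union> B - A) = A \<union> B - A"
      using \<tau> permutes_image[of \<tau> "A \<union> B"] by (simp only: roots_on_def mem_Collect_eq)
    moreover have "A \<union> B - A = B"
      using assms by auto
    ultimately show "perm_restrict \<tau> A \<in> roots_on m \<sigma> A \<and> perm_restrict \<tau> B \<in> roots_on m \<sigma> B"
      using perm_restrict_roots[OF \<tau>(1)] \<tau>(2) by simp
  qed
  show "(perm_restrict ((\<lambda>(\<alpha>, \<beta>). glue A \<alpha> \<beta>) p) A,
          perm_restrict ((\<lambda>(\<alpha>, \<beta>). glue A \<alpha> \<beta>) p) B) = p"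
    if p: "p \<in> roots_on m \<sigma> A \<times> roots_on m \<sigma> B" for p
  proof -
    obtain \<alpha> \<beta> where p_eq: "p = (\<alpha>, \<beta>)"
      by fastforce
    have "\<alpha> permutes A" "\<beta> permutes B"
      using p by (simp_all add: p_eq roots_on_def)
    then have "perm_restrict (glue A \<alpha> \<beta>) A = \<alpha>" "perm_restrict (glue A \<alpha> \<beta>) B = \<beta>"
      using assms by (auto simp: perm_restrict_def glue_def fun_eq_iff permutes_not_in)
    then show ?thesis
      by (simp add: p_eq)
  qed
  show "(\<lambda>(\<alpha>, \<beta>). glue A \<alpha> \<beta>) (perm_restrict \<tau> A, perm_restrict \<tau> B) = \<tau>"
    if "\<tau> \<in> {\<tau> \<in> roots_on m \<sigma> (A \<union> B). \<tau> ` A = A}" for \<tau>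
  proof -
    have "\<tau> permutes A \<union> B"
      using that by (simp add: roots_on_def)
    then have "\<tau> x = x" if "x \<notin> A" "x \<notin> B" for x
      using that by (simp add: permutes_not_in)
    then show ?thesis
      by (simp add: perm_restrict_def glue_def fun_eq_iff)
  qed
qed

lemma card_roots_on_union:
  assumes "A \<inter> B = {}" "\<And>\<tau>. \<tau> \<in> roots_on m \<sigma> (A \<union> B) \<Longrightarrow> \<tau> ` A = A"
  shows "card (roots_on m \<sigma> (A \<union> B)) = card (roots_on m \<sigma> A) * card (roots_on m \<sigma> B)"
proof -
  have "{\<tau> \<in> roots_on m \<sigma> (A \<union> B). \<tau> ` A = A} = roots_on m \<sigma> (A \<union> B)"
    using assms(2) by blast
  then show ?thesis
    using bij_betw_same_card[OF bij_betw_glue_roots[OF assms(1), of m \<sigma>]]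
    by (simp add: card_cartesian_product)
qed

text \<open>Once the action on \<open>A\<close> is prescribed, invariance of \<open>A\<close> is
  automatic and only the action on \<open>B\<close> remains free. This is applied with
  \<open>A\<close> the cycle of the root through a chosen point.\<close>

lemma card_roots_on_fixed_part:
  assumes "A \<inter> B = {}" "\<alpha> \<in> roots_on m \<sigma> A"
  shows "card {\<tau> \<in> roots_on m \<sigma> (A \<union> B). \<forall>x\<in>A. \<tau> x = \<alpha> x} = card (roots_on m \<sigma> B)"
proof -
  have \<alpha>: "\<alpha> permutes A"
    using assms(2) by (simp add: roots_on_def)
  have bij: "bij_betw (\<lambda>(\<alpha>, \<beta>). glue A \<alpha> \<beta>) ({\<alpha>} \<times> roots_on m \<sigma> B)
          ((\<lambda>(\<alpha>, \<beta>). glue A \<alpha> \<beta>) ` ({\<alpha>} \<times> roots_on m \<sigma> B))"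
    using assms(2)
    by (intro bij_betw_subset[OF bij_betw_glue_roots[OF assms(1), of m \<sigma>]]) auto
  have "(\<lambda>(\<alpha>, \<beta>). glue A \<alpha> \<beta>) ` ({\<alpha>} \<times> roots_on m \<sigma> B)
          = {\<tau> \<in> roots_on m \<sigma> (A \<union> B). \<forall>x\<in>A. \<tau> x = \<alpha> x}" (is "?l = ?r")
  proof
    show "?l \<subseteq> ?r"
      using glue_roots[OF assms(2) _ assms(1)] by (auto simp: glue_def)
    show "?r \<subseteq> ?l"
    proof
      fix \<tau> assume \<tau>: "\<tau> \<in> ?r"
      then have "\<tau> ` A = A"
        using permutes_image[OF \<alpha>] by (simp cong: image_cong_simp)
      with \<tau> have "\<tau> \<in> (\<lambda>(\<alpha>, \<beta>). glue A \<alpha> \<beta>) ` (roots_on m \<sigma> A \<times> roots_on m \<sigma> B)"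
        using bij_betw_imp_surj_on[OF bij_betw_glue_roots[OF assms(1), of m \<sigma>]] by simp
      then obtain \<alpha>' \<beta> where *: "\<beta> \<in> roots_on m \<sigma> B" "\<tau> = glue A \<alpha>' \<beta>"
        by auto
      \<comment> \<open>On \<open>A\<close> the map \<tau> agrees with both \<alpha>' and \<alpha>,
        and \<open>glue\<close> ignores their values elsewhere.\<close>
      then have "\<tau> = glue A \<alpha> \<beta>"
        using \<tau> by (auto simp: glue_def fun_eq_iff)
      with *(1) show "\<tau> \<in> ?l"
        by auto
    qed
  qed
  with bij_betw_same_card[OF bij] show ?thesis
    by (simp add: card_cartesian_product)
qed

section \<open>Coefficients of the exponential of a polynomial\<close>

text \<open>For finite \<open>D\<close> of positive integers, this is the coefficient of
  \<open>z ^ a\<close> in the exponential of the sum of \<open>c g * z ^ g\<close> over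
  \<open>D\<close>. Exponent vectors are functions forced to vanish off \<open>D\<close>, so that
  each vector is represented once.\<close>

definition expsum :: "nat set \<Rightarrow> (nat \<Rightarrow> real) \<Rightarrow> nat \<Rightarrow> real" where
  "expsum D c a = (\<Sum>e | (\<forall>g. g \<notin> D \<longrightarrow> e g = 0) \<and> (\<Sum>g\<in>D. g * e g) = a.
     \<Prod>g\<in>D. c g ^ e g / fact (e g))"

lemma finite_weighted_compositions:
  assumes "finite D" "0 \<notin> D"
  shows "finite {e :: nat \<Rightarrow> nat. (\<forall>g. g \<notin> D \<longrightarrow> e g = 0) \<and> (\<Sum>g\<in>D. g * e g) = a}"
proof (rule finite_subset)
  show "{e. (\<forall>g. g \<notin> D \<longrightarrow> e g = 0) \<and> (\<Sum>g\<in>D. g * e g) = a}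
          \<subseteq> {e. \<forall>g. (g \<in> D \<longrightarrow> e g \<in> {..a}) \<and> (g \<notin> D \<longrightarrow> e g = 0)}"
  proof clarsimp
    fix e g assume "g \<in> D"
    then have "e g \<le> g * e g"
      using assms(2) by (cases g) auto
    also have "\<dots> \<le> (\<Sum>g\<in>D. g * e g)"
      using \<open>g \<in> D\<close> assms(1) by (intro member_le_sum) auto
    finally show "e g \<le> (\<Sum>g\<in>D. g * e g)" .
  qed
  show "finite {e :: nat \<Rightarrow> nat. \<forall>g. (g \<in> D \<longrightarrow> e g \<in> {..a}) \<and> (g \<notin> D \<longrightarrow> e g = 0)}"
    using assms(1) by (intro finite_set_of_finite_funs) auto
qed

lemma expsum_0:
  assumes "finite D" "0 \<notin> D"
  shows "expsum D c 0 = 1"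
proof -
  have "{e :: nat \<Rightarrow> nat. (\<forall>g. g \<notin> D \<longrightarrow> e g = 0) \<and> (\<Sum>g\<in>D. g * e g) = 0} = {\<lambda>_. 0}"
    using assms by (auto simp: fun_eq_iff) metis
  then show ?thesis
    by (simp add: expsum_def)
qed

(* Coefficientwise, this is z F'(z) = z f'(z) F(z) for F = exp f, f = \<Sum> c g * z ^ g. *)
lemma expsum_rec:
  assumes "finite D" "0 \<notin> D"
  shows "real a * expsum D c a = (\<Sum>g | g \<in> D \<and> g \<le> a. real g * c g * expsum D c (a - g))"
proof -
  define E where "E a = {e :: nat \<Rightarrow> nat. (\<forall>g. g \<notin> D \<longrightarrow> e g = 0) \<and> (\<Sum>g\<in>D. g * e g) = a}" for a
  define t where "t e = (\<Prod>g\<in>D. c g ^ e g / fact (e g))" for e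
  have fin: "finite (E a)" for a
    unfolding E_def using assms by (rule finite_weighted_compositions)
  \<comment> \<open>Lowering \<open>e g\<close> by one absorbs the factor \<open>e g\<close> into
    the factorial and releases one \<open>c g\<close>. The vectors with \<open>e g = 0\<close>
    contribute nothing, so they are dropped before the reindexing.\<close>
  have shift: "(\<Sum>e\<in>E a. real (g * e g) * t e) = real g * c g * (\<Sum>e\<in>E (a - g). t e)"
    if g: "g \<in> D" "g \<le> a" for g
  proof -
    have sum_split: "(\<Sum>h\<in>D. h * e h) = g * e g + (\<Sum>h\<in>D-{g}. h * e h)" for e :: "nat \<Rightarrow> nat"
      using g assms(1) by (simp add: sum.remove)
    have t_split: "t e = c g ^ e g / fact (e g) * (\<Prod>h\<in>D-{g}. c h ^ e h / fact (e h))" for e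
      unfolding t_def using g assms(1) by (simp add: prod.remove)
    have "(\<Sum>e\<in>E a. real (g * e g) * t e) = (\<Sum>e\<in>{e\<in>E a. e g \<noteq> 0}. real (g * e g) * t e)"
      using fin by (intro sum.mono_neutral_right) auto
    also have "\<dots> = (\<Sum>e\<in>E (a - g). real g * c g * t e)"
    proof (rule sum.reindex_bij_witness[where
          i = "\<lambda>e. e(g := Suc (e g))" and j = "\<lambda>e. e(g := e g - 1)"])
      fix e assume e: "e \<in> {e\<in>E a. e g \<noteq> 0}"
      then obtain k where k: "e g = Suc k"
        by (auto simp: gr0_conv_Suc)
      show "(e(g := e g - 1))(g := Suc ((e(g := e g - 1)) g)) = e"
        using k by (auto simp: fun_eq_iff)
      show "e(g := e g - 1) \<in> E (a - g)"
        using e g k by (auto simp: E_def sum_split)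
      show "real g * c g * t (e(g := e g - 1)) = real (g * e g) * t e"
        by (simp add: t_split k field_simps del: of_nat_Suc fact_Suc cong: prod.cong_simp)
         (simp add: fact_Suc algebra_simps)
    next
      fix e assume e: "e \<in> E (a - g)"
      show "(e(g := Suc (e g)))(g := (e(g := Suc (e g))) g - 1) = e"
        by (auto simp: fun_eq_iff)
      show "e(g := Suc (e g)) \<in> {e\<in>E a. e g \<noteq> 0}"
        using e g by (auto simp: E_def sum_split)
    qed
    finally show ?thesis
      by (simp add: sum_distrib_left)
  qed
  have large: "(\<Sum>e\<in>E a. real (g * e g) * t e) = 0" if g: "g \<in> D" "\<not> g \<le> a" for g
  proof (rule sum.neutral, rule ballI)
    fix e assume "e \<in> E a"
    then have "g * e g \<le> a"
      using g(1) assms(1) by (auto simp: E_def intro: member_le_sum)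
    then have "e g = 0"
      using g(2) by (cases "e g") auto
    then show "real (g * e g) * t e = 0"
      by simp
  qed
  have "real a * expsum D c a = (\<Sum>e\<in>E a. real a * t e)"
    by (simp add: expsum_def E_def t_def sum_distrib_left)
  \<comment> \<open>The factor \<open>a\<close> is replaced by the weight
    \<open>\<Sum>g\<in>D. g * e g\<close>, which is constant on \<open>E a\<close>. Each
    \<open>g\<close> can then be treated separately by \<open>shift\<close>.\<close>
  also have "\<dots> = (\<Sum>e\<in>E a. \<Sum>g\<in>D. real (g * e g) * t e)"
  proof (rule sum.cong[OF refl])
    fix e assume "e \<in> E a"
    then have "real a = (\<Sum>g\<in>D. real (g * e g))"
      by (simp add: E_def flip: of_nat_sum of_nat_mult)
    then show "real a * t e = (\<Sum>g\<in>D. real (g * e g) * t e)"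
      by (simp add: sum_distrib_right)
  qed
  also have "\<dots> = (\<Sum>g\<in>D. \<Sum>e\<in>E a. real (g * e g) * t e)"
    by (rule sum.swap)
  also have "\<dots> = (\<Sum>g | g \<in> D \<and> g \<le> a. \<Sum>e\<in>E a. real (g * e g) * t e)"
    using assms(1) large by (intro sum.mono_neutral_right) auto
  also have "\<dots> = (\<Sum>g | g \<in> D \<and> g \<le> a. real g * c g * expsum D c (a - g))"
    by (intro sum.cong refl, subst shift) (auto simp: expsum_def E_def t_def)
  finally show ?thesis .
qed

text \<open>A part larger than \<open>a\<close> must have multiplicity 0. The recursion wants an
  index set that stays fixed while \<open>a\<close> decreases, whereas the final formula uses one
  bounded by \<open>a\<close>; this lemma connects the two.\<close>

lemma expsum_restrict:
  assumes "finite D"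
  shows "expsum D c a = expsum {g \<in> D. g \<le> a} c a"
proof -
  let ?D = "{g \<in> D. g \<le> a}"
  have vanish: "e g = 0" if "(\<Sum>g\<in>D. g * e g) = a" "g \<in> D" "\<not> g \<le> a" for e :: "nat \<Rightarrow> nat" and g
  proof -
    have "g * e g \<le> a"
      using member_le_sum[of g D "\<lambda>g. g * e g"] that assms by auto
    then show ?thesis
      using that(3) by (cases "e g") auto
  qed
  have sum_eq: "(\<Sum>g\<in>D. g * e g) = (\<Sum>g\<in>?D. g * e g)"
    if "\<And>g. g \<in> D \<Longrightarrow> \<not> g \<le> a \<Longrightarrow> e g = 0" for e :: "nat \<Rightarrow> nat"
    using that assms by (intro sum.mono_neutral_right) auto
  show ?thesis
    unfolding expsum_def
  proof (rule sum.cong)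
    show "{e. (\<forall>g. g \<notin> D \<longrightarrow> e g = 0) \<and> (\<Sum>g\<in>D. g * e g) = a} =
      {e. (\<forall>g. g \<notin> ?D \<longrightarrow> e g = 0) \<and> (\<Sum>g\<in>?D. g * e g) = a}"
      using vanish sum_eq by (intro Collect_cong) (metis (no_types, lifting) mem_Collect_eq)
    fix e assume "e \<in> {e. (\<forall>g. g \<notin> ?D \<longrightarrow> e g = 0) \<and> (\<Sum>g\<in>?D. g * e g) = a}"
    then show "(\<Prod>g\<in>D. c g ^ e g / fact (e g)) = (\<Prod>g\<in>?D. c g ^ e g / fact (e g))"
      using assms by (intro prod.mono_neutral_right) auto
  qed
qed

text \<open>Translates exponent functions into lists indexed by position in the increasing
  enumeration, as in the definition of \<E>. The two directions read a function along
  \<open>gs\<close> and look up the position \<open>idx g\<close>.\<close>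

lemma expsum_eq_sum_lists:
  assumes "finite D"
  defines "gs \<equiv> sorted_list_of_set D"
  shows "expsum D c a = (\<Sum>\<epsilon> | length \<epsilon> = card D \<and> (\<Sum>i<card D. gs ! i * \<epsilon> ! i) = a.
           \<Prod>i<card D. c (gs ! i) ^ (\<epsilon> ! i) / fact (\<epsilon> ! i))"
proof -
  have bij: "bij_betw (\<lambda>i. gs ! i) {..<card D} D"
    using assms by (intro bij_betw_nth) auto
  define idx where "idx = inv_into {..<card D} (\<lambda>i. gs ! i)"
  have idx: "gs ! idx g = g" "idx g < card D" if "g \<in> D" for g
    using bij that inv_into_into[of g "\<lambda>i. gs ! i" "{..<card D}"]
    by (auto simp: idx_def bij_betw_def f_inv_into_f)
  have idx_nth: "idx (gs ! i) = i" if "i < card D" for i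
    using bij that by (simp add: idx_def bij_betw_def inv_into_f_f)
  have gs_in: "gs ! i \<in> D" if "i < card D" for i
    using bij that by (auto simp: bij_betw_def)
  have sum_bij: "(\<Sum>g\<in>D. f g) = (\<Sum>i<card D. f (gs ! i))" for f :: "nat \<Rightarrow> nat"
    using sum.reindex_bij_betw[OF bij, of f] by simp
  have prod_bij: "(\<Prod>g\<in>D. f g) = (\<Prod>i<card D. f (gs ! i))" for f :: "nat \<Rightarrow> real"
    using prod.reindex_bij_betw[OF bij, of f] by simp
  show ?thesis
    unfolding expsum_def
  proof (rule sum.reindex_bij_witness[where
        i = "\<lambda>\<epsilon> g. if g \<in> D then \<epsilon> ! idx g else 0" and j = "\<lambda>e. map e gs"])
    have len: "length gs = card D"
      by (simp add: gs_def)
    fix e assume e: "e \<in> {e. (\<forall>g. g \<notin> D \<longrightarrow> e g = 0) \<and> (\<Sum>g\<in>D. g * e g) = a}"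
    then show "(\<lambda>g. if g \<in> D then map e gs ! idx g else 0) = e"
      using idx by (auto simp: fun_eq_iff len)
    show "map e gs \<in> {\<epsilon>. length \<epsilon> = card D \<and> (\<Sum>i<card D. gs ! i * \<epsilon> ! i) = a}"
      using e by (simp add: len sum_bij)
    show "(\<Prod>i<card D. c (gs ! i) ^ (map e gs ! i) / fact (map e gs ! i))
            = (\<Prod>g\<in>D. c g ^ e g / fact (e g))"
      by (simp add: len prod_bij)
  next
    have len: "length gs = card D"
      by (simp add: gs_def)
    fix \<epsilon> assume \<epsilon>: "\<epsilon> \<in> {\<epsilon>. length \<epsilon> = card D \<and> (\<Sum>i<card D. gs ! i * \<epsilon> ! i) = a}"
    then show "map (\<lambda>g. if g \<in> D then \<epsilon> ! idx g else 0) gs = \<epsilon>"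
      by (auto intro!: nth_equalityI simp: len gs_in idx_nth)
    show "(\<lambda>g. if g \<in> D then \<epsilon> ! idx g else 0)
            \<in> {e. (\<forall>g. g \<notin> D \<longrightarrow> e g = 0) \<and> (\<Sum>g\<in>D. g * e g) = a}"
      using \<epsilon> by (simp add: sum_bij gs_in idx_nth)
  qed
qed

section \<open>Permutations all of whose cycles have the same length\<close>

text \<open>These lists are the candidates for the beginning \<open>x, \<tau> x, ...\<close> of a
  cycle of a root, up to its first return to the \<sigma>-cycle of \<open>x\<close>.\<close>

definition transversal_lists :: "('a \<Rightarrow> 'a) \<Rightarrow> 'a set \<Rightarrow> nat \<Rightarrow> 'a list set" where
  "transversal_lists \<sigma> S k = {ys. length ys = k \<and> set ys \<subseteq> S \<and> distinct (map (orbit \<sigma>) ys)}"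

lemma finite_transversal_lists:
  assumes "finite S"
  shows "finite (transversal_lists \<sigma> S k)"
  by (rule finite_subset[OF _ finite_lists_length_eq[OF assms, of k]])
    (auto simp: transversal_lists_def)

lemma Cons_transversal_lists_iff:
  assumes "permutation \<sigma>" "x \<in> S"
  shows "x # ys \<in> transversal_lists \<sigma> S (Suc k) \<longleftrightarrow> ys \<in> transversal_lists \<sigma> (S - orbit \<sigma> x) k"
proof -
  have "orbit \<sigma> x \<notin> orbit \<sigma> ` set ys \<longleftrightarrow> set ys \<inter> orbit \<sigma> x = {}"
    using orbit_eq_if_in_orbit[OF assms(1)] permutation_self_in_orbit[OF assms(1)] by blast
  then show ?thesis
    using assms(2) by (auto simp: transversal_lists_def)
qed

text \<open>Any of the \<open>a * l\<close> points may come first; deleting its whole cycle leaves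
  \<open>a - 1\<close> cycles for the tail. For \<open>k > a\<close> the truncated difference
  produces a factor 0, as it should.\<close>

lemma card_transversal_lists:
  assumes "permutation \<sigma>" "finite S" "\<sigma> ` S = S" "\<And>x. x \<in> S \<Longrightarrow> card (orbit \<sigma> x) = l"
    and "card S = a * l"
  shows "card (transversal_lists \<sigma> S k) = (\<Prod>i<k. (a - i) * l)"
  using assms(2-)
proof (induction k arbitrary: S a)
  case 0
  have "transversal_lists \<sigma> S 0 = {[]}"
    by (auto simp: transversal_lists_def)
  then show ?case
    by simp
next
  case (Suc k)
  let ?T = "\<lambda>x. transversal_lists \<sigma> (S - orbit \<sigma> x) k"
  have card_T: "card (?T x) = (\<Prod>i<k. (a - 1 - i) * l)" if x: "x \<in> S" for x
  proof (rule Suc.IH)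
    have "orbit \<sigma> x \<subseteq> S"
      using Suc.prems(2) x by (simp add: orbit_subset_invariant)
    then show "card (S - orbit \<sigma> x) = (a - 1) * l"
      using Suc.prems x by (simp add: card_Diff_subset finite_subset diff_mult_distrib)
    show "\<sigma> ` (S - orbit \<sigma> x) = S - orbit \<sigma> x"
      using assms(1) Suc.prems(2) image_orbit_permutation by (intro image_invariant_diff)
  qed (use Suc.prems in auto)
  have "transversal_lists \<sigma> S (Suc k) = (\<Union>x\<in>S. (#) x ` ?T x)"
  proof (rule set_eqI)
    fix ys
    show "ys \<in> transversal_lists \<sigma> S (Suc k) \<longleftrightarrow> ys \<in> (\<Union>x\<in>S. (#) x ` ?T x)"
    proof (cases ys)
      case Nil
      then show ?thesis
        by (auto simp: transversal_lists_def)
    next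
      case (Cons x xs)
      have "x \<in> S" if "ys \<in> transversal_lists \<sigma> S (Suc k)"
        using that Cons by (simp add: transversal_lists_def)
      then show ?thesis
        using Cons_transversal_lists_iff[OF assms(1), of x S xs k] Cons by blast
    qed
  qed
  also have "card \<dots> = (\<Sum>x\<in>S. card ((#) x ` ?T x))"
    using Suc.prems(1) by (intro card_UN_disjoint) (auto intro: finite_transversal_lists)
  also have "\<dots> = (\<Sum>x\<in>S. \<Prod>i<k. (a - 1 - i) * l)"
    by (intro sum.cong refl) (simp add: card_image card_T)
  also have "\<dots> = (\<Prod>i<Suc k. (a - i) * l)"
    using Suc.prems(4) by (simp add: prod.lessThan_Suc_shift del: prod.lessThan_Suc)
  finally show ?case .
qed

section \<open>Periodic sequences as cycles of a root\<close>

lemma card_range_periodic_sequence: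
  fixes z :: "nat \<Rightarrow> 'a"
  assumes z_eq: "\<And>i j. z i = z j \<longleftrightarrow> [i = j] (mod L)" and "L > 0"
  shows "finite (range z)" "card (range z) = L"
proof -
  have "z n \<in> z ` {..<L}" for n
    using \<open>L > 0\<close> by (intro image_eqI[of _ _ "n mod L"]) (auto simp: z_eq)
  then have range: "range z = z ` {..<L}"
    by auto
  have "inj_on z {..<L}"
    by (auto simp: inj_on_def z_eq cong_less_modulus_unique_nat)
  then show "finite (range z)" "card (range z) = L"
    by (simp_all add: range card_image)
qed

text \<open>The root is the shift along the sequence: its \<open>m\<close>-th power advances the
  index by \<open>m\<close>, which \<open>z_add\<close> identifies with \<sigma>.\<close>

lemma root_of_periodic_sequence:
  fixes z :: "nat \<Rightarrow> 'a"
  assumes z_eq: "\<And>i j. z i = z j \<longleftrightarrow> [i = j] (mod L)" and "L > 0"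
    and z_add: "\<And>n. z (n + m) = \<sigma> (z n)"
  obtains \<tau> where "\<tau> \<in> roots_on m \<sigma> (range z)" "\<And>n. \<tau> (z n) = z (Suc n)"
proof -
  \<comment> \<open>The choice of the index is harmless: two indices of the same point are congruent
    modulo \<open>L\<close>, and so are their successors.\<close>
  define \<tau> where "\<tau> y = (if y \<in> range z then z (Suc (SOME n. z n = y)) else y)" for y
  have \<tau>: "\<tau> (z n) = z (Suc n)" for n
  proof -
    have "z (SOME k. z k = z n) = z n"
      by (rule someI) simp
    then have "[Suc (SOME k. z k = z n) = Suc n] (mod L)"
      using z_eq cong_add[OF _ cong_refl[of 1]] by fastforce
    moreover have "\<tau> (z n) = z (Suc (SOME k. z k = z n))"
      by (simp add: \<tau>_def)
    ultimately show ?thesis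
      by (simp only: z_eq)
  qed
  have "z n \<in> \<tau> ` range z" for n
  proof -
    \<comment> \<open>Going forward by \<open>L - 1\<close> yields a predecessor, also when
      \<open>n = 0\<close>.\<close>
    have "z n = z (Suc (n + (L - 1)))"
      using \<open>L > 0\<close> by (simp add: z_eq cong_def)
    then show ?thesis
      by (metis \<tau> rangeI image_eqI)
  qed
  moreover have "\<tau> ` range z \<subseteq> range z"
    using \<tau> by auto
  ultimately have "\<tau> ` range z = range z"
    by blast
  moreover have "finite (range z)"
    using assms(1,2) by (rule card_range_periodic_sequence)
  ultimately have "bij_betw \<tau> (range z) (range z)"
    by (simp add: bij_betw_def finite_surj_inj)
  then have "\<tau> permutes range z"
    by (rule bij_imp_permutes) (simp add: \<tau>_def)
  moreover have "(\<tau> ^^ k) (z n) = z (n + k)" for k n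
    by (induction k) (simp_all add: \<tau>)
  ultimately have "\<tau> \<in> roots_on m \<sigma> (range z)"
    by (auto simp: roots_on_def z_add)
  with \<tau> that show thesis
    by blast
qed

(* If t ^ m = s has a cycle through xs ! 0 that begins with xs and meets g = length xs cycles of s,
   then t ^ g = s ^ u on it for u * (m div g) = 1 modulo l, so spiral lists this whole cycle. *)
definition spiral :: "('a \<Rightarrow> 'a) \<Rightarrow> nat \<Rightarrow> 'a list \<Rightarrow> nat \<Rightarrow> 'a" where
  "spiral \<sigma> u xs n = (\<sigma> ^^ (u * (n div length xs))) (xs ! (n mod length xs))"

lemma spiral_nth: "i < length xs \<Longrightarrow> spiral \<sigma> u xs i = xs ! i"
  by (simp add: spiral_def)

lemma spiral_in_invariant:
  assumes "\<sigma> ` S \<subseteq> S" "set xs \<subseteq> S" "xs \<noteq> []"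
  shows "spiral \<sigma> u xs n \<in> S"
proof -
  have "xs ! (n mod length xs) \<in> S"
    using assms nth_mem[of "n mod length xs" xs] by auto
  then show ?thesis
    unfolding spiral_def using assms(1) by (rule funpow_in_invariant[rotated])
qed

text \<open>The residue of an index modulo \<open>length xs\<close> determines the \<sigma>-cycle,
  since the entries lie in distinct cycles. The quotient determines the place in that cycle modulo
  \<open>l\<close>, since \<open>u\<close> is invertible there.\<close>

lemma spiral_eq_iff:
  assumes \<sigma>: "permutation \<sigma>" "\<And>x. x \<in> set xs \<Longrightarrow> card (orbit \<sigma> x) = l"
    and xs: "distinct (map (orbit \<sigma>) xs)" "xs \<noteq> []" and u: "coprime u l"
  shows "spiral \<sigma> u xs i = spiral \<sigma> u xs j \<longleftrightarrow> [i = j] (mod (length xs * l))"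
proof -
  let ?g = "length xs"
  have in_range: "k mod ?g < ?g" for k
    using xs(2) by simp
  have orbit: "orbit \<sigma> (spiral \<sigma> u xs k) = orbit \<sigma> (xs ! (k mod ?g))" for k
    using \<sigma>(1) by (simp add: spiral_def orbit_eq_if_in_orbit funpow_in_orbit_self)
  show ?thesis
  proof (cases "i mod ?g = j mod ?g")
    case True
    have "card (orbit \<sigma> (xs ! (j mod ?g))) = l"
      using in_range by (intro \<sigma>(2)) simp
    then have "spiral \<sigma> u xs i = spiral \<sigma> u xs j \<longleftrightarrow> [u * (i div ?g) = u * (j div ?g)] (mod l)"
      using True by (simp add: spiral_def funpow_eq_iff_cong_card_orbit[OF \<sigma>(1)])
    also have "\<dots> \<longleftrightarrow> [i div ?g = j div ?g] (mod l)"
      using u by (rule cong_mult_lcancel_nat)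
    also have "\<dots> \<longleftrightarrow> i mod (?g * l) = j mod (?g * l)"
      using True xs(2) by (simp add: cong_def mod_mult2_eq)
    finally show ?thesis
      by (simp add: cong_def)
  next
    case False
    then have "orbit \<sigma> (xs ! (i mod ?g)) \<noteq> orbit \<sigma> (xs ! (j mod ?g))"
      using xs(1) in_range by (simp add: distinct_conv_nth)
    moreover have "\<not> [i = j] (mod (?g * l))"
      using False by (metis cong_def cong_modulus_mult_nat)
    ultimately show ?thesis
      using orbit by metis
  qed
qed

text \<open>As \<open>length xs\<close> divides \<open>m\<close>, adding \<open>m\<close> keeps the
  residue and raises the quotient by \<open>m div length xs\<close>. Multiplied by \<open>u\<close>
  this is 1 modulo \<open>l\<close>, that is, one more application of \<sigma>.\<close>

lemma spiral_add:
  assumes "permutation \<sigma>" "\<And>x. x \<in> set xs \<Longrightarrow> card (orbit \<sigma> x) = l"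
    and "xs \<noteq> []" "length xs dvd m" "[u * (m div length xs) = 1] (mod l)"
  shows "spiral \<sigma> u xs (n + m) = \<sigma> (spiral \<sigma> u xs n)"
proof -
  let ?g = "length xs"
  have div: "(n + m) div ?g = n div ?g + m div ?g" and mod: "(n + m) mod ?g = n mod ?g"
    using assms(4) by (auto simp: div_plus_div_distrib_dvd_right)
  have card: "card (orbit \<sigma> (xs ! (n mod ?g))) = l"
    using assms(3) by (intro assms(2)) simp
  have "[u * ((n + m) div ?g) = Suc (u * (n div ?g))] (mod l)"
    using cong_add[OF cong_refl[of "u * (n div ?g)"] assms(5)] by (simp add: div distrib_left)
  then have "(\<sigma> ^^ (u * ((n + m) div ?g))) (xs ! (n mod ?g)) =
      (\<sigma> ^^ Suc (u * (n div ?g))) (xs ! (n mod ?g))"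
    using funpow_eq_iff_cong_card_orbit[OF assms(1)] card by metis
  then show ?thesis
    by (simp add: spiral_def mod)
qed

lemma image_range_shift:
  fixes z :: "nat \<Rightarrow> 'a"
  assumes "\<And>i j. z i = z j \<longleftrightarrow> [i = j] (mod L)" "L > 0" "\<And>n. z (n + m) = \<sigma> (z n)"
  shows "\<sigma> ` range z = range z"
proof
  show "\<sigma> ` range z \<subseteq> range z"
    by (auto simp flip: assms(3))
  show "range z \<subseteq> \<sigma> ` range z"
  proof clarify
    fix n
    \<comment> \<open>Modulo \<open>L\<close>, advancing by \<open>m * (L - 1)\<close> is going back
      by \<open>m\<close>, which provides a preimage under \<sigma>.\<close>
    have "n + m * (L - 1) + m = n + m * L"
      using assms(2) by (cases L) auto
    moreover have "z n = z (n + m * L)"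
      by (simp add: assms(1) cong_def)
    ultimately have "z n = \<sigma> (z (n + m * (L - 1)))"
      by (metis assms(3))
    then show "z n \<in> \<sigma> ` range z"
      by blast
  qed
qed

section \<open>The cycle of a root through a given point\<close>

lemma roots_on_funpow:
  assumes "\<tau> \<in> roots_on m \<sigma> S" "x \<in> S"
  shows "(\<tau> ^^ (n + m * k)) x = (\<sigma> ^^ k) ((\<tau> ^^ n) x)"
proof (induction k)
  case (Suc k)
  have "\<tau> ` S = S"
    using assms(1) by (auto simp: roots_on_def permutes_image)
  then have "(\<tau> ^^ (n + m * k)) x \<in> S"
    using assms(2) by (simp add: funpow_in_invariant)
  then have "(\<tau> ^^ m) ((\<tau> ^^ (n + m * k)) x) = \<sigma> ((\<tau> ^^ (n + m * k)) x)"
    using assms(1) by (simp add: roots_on_def)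
  moreover have "(\<tau> ^^ (n + m * Suc k)) x = (\<tau> ^^ m) ((\<tau> ^^ (n + m * k)) x)"
    by (simp add: add.commute add.left_commute flip: funpow_add[THEN fun_cong, unfolded comp_def])
  ultimately show ?case
    using Suc.IH by simp
qed simp

text \<open>Shows that spirals miss no root. On a \<tau>-cycle of length \<open>L\<close>, the power
  \<open>\<tau> ^^ m\<close> has \<open>gcd L m\<close> cycles of equal length; since that power is
  \<sigma>, their length is \<open>l\<close>. The inverses \<open>u g\<close> are fixed in advance
  so that the spiral depends on \<open>g\<close> and \<open>xs\<close> alone.\<close>

lemma root_orbit_spiral:
  assumes \<sigma>: "permutation \<sigma>" "\<sigma> ` S = S" "\<And>x. x \<in> S \<Longrightarrow> card (orbit \<sigma> x) = l"
    and S: "finite S" "x \<in> S" and m: "m > 0" and \<tau>: "\<tau> \<in> roots_on m \<sigma> S"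
    and u: "\<And>g. gcd (g * l) m = g \<Longrightarrow> [u g * (m div g) = 1] (mod l)"
  obtains g xs where "g > 0" "gcd (g * l) m = g" "g * l \<le> card S"
    "xs \<in> transversal_lists \<sigma> S g" "hd xs = x" "\<And>n. (\<tau> ^^ n) x = spiral \<sigma> (u g) xs n"
proof -
  have \<tau>_perm: "permutation \<tau>" and \<tau>_inv: "\<tau> ` S = S"
    using \<tau> S(1) by (auto simp: roots_on_def permutation_permutes permutes_image)
  define L where "L = card (orbit \<tau> x)"
  have w_eq: "(\<tau> ^^ i) x = (\<tau> ^^ j) x \<longleftrightarrow> [i = j] (mod L)" for i j
    unfolding L_def by (rule funpow_eq_iff_cong_card_orbit[OF \<tau>_perm])
  have w_add: "(\<tau> ^^ (n + m * k)) x = (\<sigma> ^^ k) ((\<tau> ^^ n) x)" for n k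
    using \<tau> S(2) by (rule roots_on_funpow)
  have w_S: "(\<tau> ^^ n) x \<in> S" for n
    using \<tau>_inv S(2) by (simp add: funpow_in_invariant)
  define g where "g = gcd L m"
  have g: "g > 0" "g dvd L" "g dvd m"
    using m by (simp_all add: g_def)
  have L_pos: "L > 0"
    unfolding L_def using \<tau>_perm by (rule card_orbit_pos)
  \<comment> \<open>Both \<open>l\<close> and \<open>L div g\<close> are compared through their
    multiples: \<open>\<sigma> ^^ k\<close> fixes \<open>x\<close> iff \<open>L\<close> divides
    \<open>m * k\<close>, and after cancelling \<open>g\<close> the factor \<open>m div g\<close> is
    coprime to \<open>L div g\<close>.\<close>
  have l_eq: "l dvd k \<longleftrightarrow> L div g dvd k" for k
  proof -
    have "l dvd k \<longleftrightarrow> (\<sigma> ^^ k) x = (\<sigma> ^^ 0) x"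
      using \<sigma>(3)[OF S(2)] by (subst funpow_eq_iff_cong_card_orbit[OF \<sigma>(1)]) (simp add: cong_0_iff)
    also have "\<dots> \<longleftrightarrow> (\<tau> ^^ (m * k)) x = (\<tau> ^^ 0) x"
      using w_add[of 0 k] by simp
    also have "\<dots> \<longleftrightarrow> L dvd m * k"
      by (subst w_eq) (simp add: cong_0_iff)
    also have "\<dots> \<longleftrightarrow> g * (L div g) dvd g * ((m div g) * k)"
      using g by (simp flip: mult.assoc)
    also have "\<dots> \<longleftrightarrow> L div g dvd (m div g) * k"
      using g(1) by simp
    also have "\<dots> \<longleftrightarrow> L div g dvd k"
    proof (rule coprime_dvd_mult_right_iff)
      show "coprime (L div g) (m div g)"
        unfolding g_def using m by (intro div_gcd_coprime) simp
    qed
    finally show ?thesis .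
  qed
  have "l = L div g"
    using l_eq[of l] l_eq[of "L div g"] by (simp add: dvd_antisym)
  then have L: "L = g * l"
    using g(2) by simp
  then have gcd: "gcd (g * l) m = g"
    by (simp add: g_def)
  define xs where "xs = map (\<lambda>i. (\<tau> ^^ i) x) [0..<g]"
  have len: "length xs = g"
    by (simp add: xs_def)
  have spiral: "(\<tau> ^^ n) x = spiral \<sigma> (u g) xs n" for n
  proof -
    \<comment> \<open>Multiplying this congruence by \<open>g\<close> lifts it to modulus
      \<open>L\<close> and turns \<open>m div g\<close> into \<open>m\<close>. Hence
      \<open>n\<close> may be replaced by \<open>n mod g\<close> plus a multiple of
      \<open>m\<close>, and \<open>w_add\<close> converts that multiple into a power of
      \<sigma>.\<close>
    have "[m div g * (u g * (n div g)) = 1 * (n div g)] (mod l)"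
      using cong_scalar_right[OF u[OF gcd], of "n div g"] by (simp add: ac_simps)
    then have "(g * (m div g * (u g * (n div g)))) mod L = (g * (n div g)) mod L"
      unfolding L by (simp add: cong_def)
    then have "[n mod g + m * (u g * (n div g)) = n mod g + g * (n div g)] (mod L)"
      using g(3) by (intro cong_add cong_refl) (simp add: cong_def flip: mult.assoc)
    then have "(\<tau> ^^ (n mod g + m * (u g * (n div g)))) x = (\<tau> ^^ n) x"
      by (simp add: w_eq)
    then show ?thesis
      using g(1) w_add[of "n mod g" "u g * (n div g)"] by (simp add: spiral_def len) (simp add: xs_def)
  qed
  \<comment> \<open>Moving within a \<sigma>-cycle changes the index by multiples of
    \<open>m\<close> modulo \<open>L\<close>. Since \<open>g\<close> divides both, the index modulo
    \<open>g\<close> is unchanged.\<close>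
  have "i = j" if ij: "i < g" "j < g" "orbit \<sigma> ((\<tau> ^^ i) x) = orbit \<sigma> ((\<tau> ^^ j) x)" for i j
  proof -
    have "(\<tau> ^^ j) x \<in> orbit \<sigma> ((\<tau> ^^ i) x)"
      using ij(3) permutation_self_in_orbit[OF \<sigma>(1)] by simp
    then obtain k where "(\<tau> ^^ j) x = (\<sigma> ^^ k) ((\<tau> ^^ i) x)"
      using \<sigma>(1) by (auto simp: orbit_altdef_permutation)
    then have "[j = i + m * k] (mod L)"
      by (simp add: w_eq flip: w_add)
    then have "[j = i + m * k] (mod g)"
      using g(2) cong_dvd_modulus_nat by blast
    moreover have "[i + m * k = i] (mod g)"
      using g(3) by (simp add: cong_add_lcancel_0_nat cong_0_iff)
    ultimately have "[j = i] (mod g)"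
      by (rule cong_trans)
    then show ?thesis
      using ij cong_less_modulus_unique_nat by metis
  qed
  then have "xs \<in> transversal_lists \<sigma> S g"
    using w_S by (auto simp: transversal_lists_def xs_def distinct_conv_nth)
  moreover have "orbit \<tau> x \<subseteq> S"
    using \<tau>_inv S(2) by (simp add: orbit_subset_invariant)
  then have "g * l \<le> card S"
    using S(1) by (simp add: L_def card_mono flip: L)
  moreover have "hd xs = x"
    using g(1) by (simp add: xs_def hd_map)
  ultimately show thesis
    using that g(1) gcd spiral by blast
qed

text \<open>Prescribing all iterates of \<open>z 0\<close> amounts to prescribing the root on
  \<open>range z\<close>, where it must be the shift. What is left is a root on the
  complement.\<close>

lemma card_roots_on_spiral:
  assumes z_eq: "\<And>i j. z i = z j \<longleftrightarrow> [i = j] (mod L)" and "L > 0"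
    and z_add: "\<And>n. z (n + m) = \<sigma> (z n)" and "range z \<subseteq> S"
  shows "card {\<tau> \<in> roots_on m \<sigma> S. \<forall>n. (\<tau> ^^ n) (z 0) = z n} = card (roots_on m \<sigma> (S - range z))"
proof -
  obtain \<rho> where \<rho>: "\<rho> \<in> roots_on m \<sigma> (range z)" "\<And>n. \<rho> (z n) = z (Suc n)"
    using root_of_periodic_sequence[where z = z and \<sigma> = \<sigma>, OF assms(1-3)] by blast
  have "(\<forall>n. (\<tau> ^^ n) (z 0) = z n) \<longleftrightarrow> (\<forall>y\<in>range z. \<tau> y = \<rho> y)" for \<tau>
  proof
    assume *: "\<forall>n. (\<tau> ^^ n) (z 0) = z n"
    have "\<tau> (z n) = z (Suc n)" for n
      using *[rule_format, of n] *[rule_format, of "Suc n"] by simp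
    then show "\<forall>y\<in>range z. \<tau> y = \<rho> y"
      by (auto simp: \<rho>(2))
  next
    assume *: "\<forall>y\<in>range z. \<tau> y = \<rho> y"
    have "(\<tau> ^^ n) (z 0) = z n" for n
      by (induction n) (use * \<rho>(2) in auto)
    then show "\<forall>n. (\<tau> ^^ n) (z 0) = z n"
      by blast
  qed
  moreover have "S = range z \<union> (S - range z)"
    using assms(4) by blast
  ultimately show ?thesis
    using card_roots_on_fixed_part[OF _ \<rho>(1), of "S - range z"] by simp
qed

section \<open>The recursion for the number of roots\<close>

lemma prod_diff_mult_fact:
  "k \<le> n \<Longrightarrow> (\<Prod>i<k. n - i) * fact (n - k) = (fact n :: nat)"
proof (induction k)
  case (Suc k)
  then have "n - k = Suc (n - Suc k)"
    by simp
  then have "fact (n - k) = (n - k) * (fact (n - Suc k) :: nat)"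
    by (metis fact_Suc of_nat_id)
  with Suc show ?case
    by (simp add: ac_simps)
qed simp

text \<open>The roots are classified by the pair \<open>(g, xs)\<close> describing their cycle
  through \<open>x\<close>. The function \<open>f\<close> stands for the count on smaller invariant
  sets, which depends only on the number of cycles; an induction hypothesis will supply it.\<close>

lemma card_roots_on_uniform_rec:
  assumes \<sigma>: "permutation \<sigma>" "\<sigma> ` S = S" "\<And>x. x \<in> S \<Longrightarrow> card (orbit \<sigma> x) = l"
    and S: "finite S" "card S = a * l" "x \<in> S" and m: "m > 0"
    and f: "\<And>b T. \<lbrakk>b < a; T \<subseteq> S; \<sigma> ` T = T; card T = b * l\<rbrakk> \<Longrightarrow> real (card (roots_on m \<sigma> T)) = f b"
  shows "real (card (roots_on m \<sigma> S)) =
    (\<Sum>g\<in>G m l a. real (l ^ (g - 1) * (\<Prod>i<g-1. a - 1 - i)) * f (a - g))"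
proof -
  have l: "l > 0"
    using card_orbit_pos[OF \<sigma>(1), of x] \<sigma>(3)[OF S(3)] by simp
  \<comment> \<open>Dividing \<open>gcd (g * l) m = g\<close> by \<open>g\<close> shows that
    \<open>m div g\<close> and \<open>l\<close> are coprime.\<close>
  have "\<exists>u. [u * (m div g) = 1] (mod l)" if "gcd (g * l) m = g" for g
  proof -
    have "g > 0"
      using that m by (metis gcd_eq_0_iff gr0I less_not_refl3)
    moreover have "gcd (g * l) (g * (m div g)) = g"
      using that by (metis dvd_mult_div_cancel gcd_dvd2)
    ultimately have "coprime (m div g) l"
      by (simp add: gcd_mult_distrib_nat[symmetric] coprime_iff_gcd_eq_1 gcd.commute)
    then show ?thesis
      using cong_solve_coprime_nat by (metis One_nat_def mult.commute)
  qed
  then obtain u where u: "[u g * (m div g) = 1] (mod l)" if "gcd (g * l) m = g" for g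
    by metis
  \<comment> \<open>\<open>X g\<close> holds the possible beginnings with head \<open>x\<close>, and
    \<open>R g xs\<close> the roots whose cycle through \<open>x\<close> is the spiral of
    \<open>xs\<close>.\<close>
  define X where "X g = {xs \<in> transversal_lists \<sigma> S g. hd xs = x}" for g
  define R where "R g xs = {\<tau> \<in> roots_on m \<sigma> S. \<forall>n. (\<tau> ^^ n) x = spiral \<sigma> (u g) xs n}" for g xs
  have finX: "finite (X g)" for g
    unfolding X_def using finite_transversal_lists[OF S(1)] by simp
  have cardX: "card (X g) = l ^ (g - 1) * (\<Prod>i<g-1. a - 1 - i)" if "g > 0" for g
  proof -
    \<comment> \<open>The head is fixed, so only \<open>g - 1\<close> entries are free, and they
      come from the other \<open>a - 1\<close> cycles.\<close>
    have "X g = (#) x ` transversal_lists \<sigma> (S - orbit \<sigma> x) (g - 1)"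
    proof (rule set_eqI)
      fix xs
      have "length xs = g" if "xs \<in> X g"
        using that by (simp add: X_def transversal_lists_def)
      then show "xs \<in> X g \<longleftrightarrow> xs \<in> (#) x ` transversal_lists \<sigma> (S - orbit \<sigma> x) (g - 1)"
        using \<open>g > 0\<close> Cons_transversal_lists_iff[OF \<sigma>(1) S(3), of "tl xs" "g - 1"]
        by (cases xs) (auto simp: X_def)
    qed
    then have "card (X g) = card (transversal_lists \<sigma> (S - orbit \<sigma> x) (g - 1))"
      by (simp add: card_image)
    also have "\<dots> = (\<Prod>i<g-1. (a - 1 - i) * l)"
    proof (rule card_transversal_lists[OF \<sigma>(1)])
      have "orbit \<sigma> x \<subseteq> S"
        using \<sigma>(2) S(3) by (simp add: orbit_subset_invariant)
      then show "card (S - orbit \<sigma> x) = (a - 1) * l"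
        using S \<sigma>(3) by (simp add: card_Diff_subset finite_subset diff_mult_distrib)
      show "\<sigma> ` (S - orbit \<sigma> x) = S - orbit \<sigma> x"
        using \<sigma>(1,2) image_orbit_permutation by (intro image_invariant_diff)
    qed (use S(1) \<sigma>(3) in auto)
    finally show ?thesis
      by (simp add: prod.distrib)
  qed
  have xs_props: "length xs = g" "xs \<noteq> []" "set xs \<subseteq> S" "distinct (map (orbit \<sigma>) xs)"
      "spiral \<sigma> (u g) xs 0 = x" if "g \<in> G m l a" "xs \<in> X g" for g xs
    using that by (cases xs; auto simp: G_def X_def transversal_lists_def spiral_nth)+
  have z_eq: "spiral \<sigma> (u g) xs i = spiral \<sigma> (u g) xs j \<longleftrightarrow> [i = j] (mod (g * l))"
    if gx: "g \<in> G m l a" "xs \<in> X g" for g xs i j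
  proof -
    have "coprime (u g) l"
      using u[of g] gx(1) by (auto simp: G_def coprime_iff_invertible_nat)
    then show ?thesis
      using spiral_eq_iff[OF \<sigma>(1), of xs l "u g" i j] \<sigma>(3) xs_props[OF gx] by auto
  qed
  have z_add: "spiral \<sigma> (u g) xs (n + m) = \<sigma> (spiral \<sigma> (u g) xs n)"
    if gx: "g \<in> G m l a" "xs \<in> X g" for g xs n
  proof (rule spiral_add[OF \<sigma>(1)])
    have gcd: "gcd (g * l) m = g"
      using gx(1) by (simp add: G_def)
    show "length xs dvd m"
      using xs_props(1)[OF gx] gcd by (metis gcd_dvd2)
    show "[u g * (m div length xs) = 1] (mod l)"
      using xs_props(1)[OF gx] u[OF gcd] by simp
  qed (use xs_props[OF gx] \<sigma>(3) in auto)
  have cardR: "real (card (R g xs)) = f (a - g)" if gx: "g \<in> G m l a" "xs \<in> X g" for g xs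
  proof -
    let ?z = "spiral \<sigma> (u g) xs"
    have pos: "g * l > 0" and ga: "0 < g" "g \<le> a"
      using gx(1) l by (auto simp: G_def)
    have range: "range ?z \<subseteq> S"
      using \<sigma>(2) xs_props[OF gx] spiral_in_invariant by (metis image_subsetI subset_refl)
    have "real (card (R g xs)) = real (card (roots_on m \<sigma> (S - range ?z)))"
      using card_roots_on_spiral[OF z_eq[OF gx] pos z_add[OF gx] range] xs_props(5)[OF gx]
      by (simp add: R_def)
    also have "\<dots> = f (a - g)"
    proof (rule f)
      show "card (S - range ?z) = (a - g) * l"
        using card_range_periodic_sequence[OF z_eq[OF gx] pos] range S(2)
        by (simp add: card_Diff_subset diff_mult_distrib)
      show "\<sigma> ` (S - range ?z) = S - range ?z"
        using image_range_shift[OF z_eq[OF gx] pos z_add[OF gx]] \<sigma>(1,2)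
        by (intro image_invariant_diff)
    qed (use ga in auto)
    finally show ?thesis .
  qed
  \<comment> \<open>A root determines its pair: the period \<open>g * l\<close> of the iterates of
    \<open>x\<close> gives \<open>g\<close>, and the first \<open>g\<close> iterates are the entries
    of \<open>xs\<close>.\<close>
  have disjoint: "g = g' \<and> xs = xs'"
    if gx: "g \<in> G m l a" "xs \<in> X g" and gx': "g' \<in> G m l a" "xs' \<in> X g'"
      and \<tau>: "\<tau> \<in> R g xs" "\<tau> \<in> R g' xs'" for g xs g' xs' \<tau>
  proof -
    have eq: "spiral \<sigma> (u g) xs n = spiral \<sigma> (u g') xs' n" for n
      using \<tau> by (simp add: R_def)
    have "[g * l = 0] (mod (g' * l))"
      using z_eq[OF gx, of "g * l" 0] by (simp add: eq z_eq[OF gx'] cong_0_iff)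
    moreover have "[g' * l = 0] (mod (g * l))"
      using z_eq[OF gx', of "g' * l" 0] by (simp add: z_eq[OF gx] cong_0_iff flip: eq)
    ultimately have "g * l = g' * l"
      by (metis cong_0_iff dvd_antisym)
    then have g: "g = g'"
      using l by simp
    have "xs ! i = xs' ! i" if "i < g" for i
      using eq[of i] that xs_props(1)[OF gx] xs_props(1)[OF gx'] g by (simp add: spiral_nth)
    then show ?thesis
      using g xs_props(1)[OF gx] xs_props(1)[OF gx'] by (simp add: nth_equalityI)
  qed
  have "roots_on m \<sigma> S = (\<Union>(g, xs)\<in>Sigma (G m l a) X. R g xs)"
  proof
    show "roots_on m \<sigma> S \<subseteq> (\<Union>(g, xs)\<in>Sigma (G m l a) X. R g xs)"
    proof
      fix \<tau> assume \<tau>: "\<tau> \<in> roots_on m \<sigma> S"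
      obtain g xs where gx: "g > 0" "gcd (g * l) m = g" "g * l \<le> card S"
        "xs \<in> transversal_lists \<sigma> S g" "hd xs = x" "\<And>n. (\<tau> ^^ n) x = spiral \<sigma> (u g) xs n"
        using root_orbit_spiral[OF \<sigma> S(1,3) m \<tau> u] by blast
      then have "g \<in> G m l a"
        using S(2) l by (simp add: G_def)
      moreover have "xs \<in> X g" "\<tau> \<in> R g xs"
        using gx \<tau> by (simp_all add: X_def R_def)
      ultimately show "\<tau> \<in> (\<Union>(g, xs)\<in>Sigma (G m l a) X. R g xs)"
        by blast
    qed
  qed (auto simp: R_def)
  then have "card (roots_on m \<sigma> S) = card (\<Union>(g, xs)\<in>Sigma (G m l a) X. R g xs)"
    by simp
  also have "\<dots> = (\<Sum>(g, xs)\<in>Sigma (G m l a) X. card (R g xs))"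
  proof (subst card_UN_disjoint)
    show "finite (Sigma (G m l a) X)"
      by (simp add: finite_G finX)
    show "\<forall>p\<in>Sigma (G m l a) X. finite (case p of (g, xs) \<Rightarrow> R g xs)"
      using finite_roots_on[OF S(1)] by (auto simp: R_def)
    show "\<forall>p\<in>Sigma (G m l a) X. \<forall>q\<in>Sigma (G m l a) X. p \<noteq> q \<longrightarrow>
        (case p of (g, xs) \<Rightarrow> R g xs) \<inter> (case q of (g, xs) \<Rightarrow> R g xs) = {}"
      using disjoint by fast
  qed (auto intro: sum.cong)
  also have "\<dots> = (\<Sum>g\<in>G m l a. \<Sum>xs\<in>X g. card (R g xs))"
    by (simp add: sum.Sigma finite_G finX)
  finally have "real (card (roots_on m \<sigma> S)) = (\<Sum>g\<in>G m l a. \<Sum>xs\<in>X g. real (card (R g xs)))"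
    by simp
  also have "\<dots> = (\<Sum>g\<in>G m l a. real (card (X g)) * f (a - g))"
    by (intro sum.cong refl) (simp add: cardR)
  also have "\<dots> = (\<Sum>g\<in>G m l a. real (l ^ (g - 1) * (\<Prod>i<g-1. a - 1 - i)) * f (a - g))"
    by (intro sum.cong refl) (simp add: cardX G_def)
  finally show ?thesis .
qed

text \<open>This is \<open>G m l a\<close> without the bound by \<open>a\<close>, hence an index set
  that does not change along the recursion. It is finite because its members divide
  \<open>m\<close>.\<close>

definition admissible :: "nat \<Rightarrow> nat \<Rightarrow> nat set" where
  "admissible m l = {g. 0 < g \<and> gcd (g * l) m = g}"

lemma finite_admissible:
  assumes "m > 0"
  shows "finite (admissible m l)"
proof (rule finite_subset)
  show "admissible m l \<subseteq> {..m}"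
    using assms by (auto simp: admissible_def intro: dvd_imp_le) (metis gcd_le2_nat less_not_refl2)
qed simp

lemma zero_notin_admissible: "0 \<notin> admissible m l"
  by (simp add: admissible_def)

lemma G_eq_admissible: "G m l a = {g \<in> admissible m l. g \<le> a}"
  by (auto simp: G_def admissible_def)

text \<open>Strong induction on the number of cycles: after division by \<open>fact a\<close>, the
  recursion for the roots is the one in \<open>expsum_rec\<close>.\<close>

lemma card_roots_on_uniform:
  assumes \<sigma>: "permutation \<sigma>" and m: "m > 0" and "l > 0"
    and "finite S" "\<sigma> ` S = S" "\<And>x. x \<in> S \<Longrightarrow> card (orbit \<sigma> x) = l" "card S = a * l"
  shows "real (card (roots_on m \<sigma> S)) =
    fact a * expsum (admissible m l) (\<lambda>g. real l ^ (g - 1) / real g) a"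
  using assms(4-)
proof (induction a arbitrary: S rule: less_induct)
  case (less a)
  let ?F = "expsum (admissible m l) (\<lambda>g. real l ^ (g - 1) / real g)"
  show ?case
  proof (cases "S = {}")
    case True
    then have "a = 0"
      using less.prems \<open>l > 0\<close> by simp
    then show ?thesis
      using True by (simp add: roots_on_empty expsum_0 finite_admissible[OF m] zero_notin_admissible)
  next
    case False
    then obtain x where x: "x \<in> S"
      by blast
    have a: "a > 0"
      using less.prems False by (cases a) auto
    have "real (card (roots_on m \<sigma> S)) =
        (\<Sum>g\<in>G m l a. real (l ^ (g - 1) * (\<Prod>i<g-1. a - 1 - i)) * (fact (a - g) * ?F (a - g)))"
      using \<sigma> less.prems(2,3,1,4) x m
    proof (rule card_roots_on_uniform_rec)
      show "real (card (roots_on m \<sigma> T)) = fact b * ?F b"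
        if "b < a" "T \<subseteq> S" "\<sigma> ` T = T" "card T = b * l" for b T
        using that less.prems by (intro less.IH) (auto intro: finite_subset)
    qed
    \<comment> \<open>The falling product times \<open>fact (a - g)\<close> is
      \<open>fact (a - 1)\<close>, because \<open>a - g = (a - 1) - (g - 1)\<close> for
      \<open>g \<ge> 1\<close>. Multiplying and dividing by \<open>g\<close> produces the shape
      \<open>g * c g\<close> of \<open>expsum_rec\<close>.\<close>
    also have "\<dots> = (\<Sum>g\<in>G m l a. fact (a - 1) * (real g * (real l ^ (g - 1) / real g) * ?F (a - g)))"
    proof (rule sum.cong[OF refl])
      fix g assume "g \<in> G m l a"
      then have g: "1 \<le> g" "g \<le> a"
        by (simp_all add: G_def)
      then have "(\<Prod>i<g-1. a - 1 - i) * fact (a - g) = (fact (a - 1) :: nat)"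
        using prod_diff_mult_fact[of "g - 1" "a - 1"] by simp
      then have "real (\<Prod>i<g-1. a - 1 - i) * fact (a - g) = fact (a - 1)"
        by (metis of_nat_fact of_nat_mult)
      moreover have "real (l ^ (g - 1) * (\<Prod>i<g-1. a - 1 - i)) * (fact (a - g) * ?F (a - g))
          = real (\<Prod>i<g-1. a - 1 - i) * fact (a - g) * (real l ^ (g - 1) * ?F (a - g))"
        by (simp only: of_nat_mult of_nat_power ac_simps)
      ultimately show "real (l ^ (g - 1) * (\<Prod>i<g-1. a - 1 - i)) * (fact (a - g) * ?F (a - g))
          = fact (a - 1) * (real g * (real l ^ (g - 1) / real g) * ?F (a - g))"
        using g by simp
    qed
    also have "\<dots> = fact (a - 1) * (real a * ?F a)"
      by (simp only: expsum_rec[OF finite_admissible[OF m] zero_notin_admissible]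
          G_eq_admissible sum_distrib_left)
    also have "\<dots> = fact a * ?F a"
      using a by (simp add: fact_reduce)
    finally show ?thesis .
  qed
qed

section \<open>Separating the cycle lengths\<close>

lemma card_orbit_root_image:
  assumes \<sigma>: "permutation \<sigma>" "\<sigma> ` S \<subseteq> S" and "\<tau> \<in> roots_on m \<sigma> S" "x \<in> S"
  shows "card (orbit \<sigma> (\<tau> x)) = card (orbit \<sigma> x)"
proof -
  have "orbit \<sigma> x \<subseteq> S"
    using assms by (simp add: orbit_subset_invariant)
  then have "\<tau> ` orbit \<sigma> x = orbit \<sigma> (\<tau> x)"
    using roots_on_commute[OF assms(3)] permutation_self_in_orbit[OF assms(1)]
    by (intro orbit_inverse) (simp_all add: subset_iff)
  moreover have "inj \<tau>"
    using assms(3) by (auto simp: roots_on_def permutes_inj)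
  then have "inj_on \<tau> (orbit \<sigma> x)"
    by (rule inj_on_subset) simp
  ultimately show ?thesis
    by (metis card_image)
qed

lemma image_lengths:
  assumes "permutation \<sigma>" "\<sigma> ` A = A"
  shows "\<sigma> ` {x \<in> A. card (orbit \<sigma> x) \<in> L} = {x \<in> A. card (orbit \<sigma> x) \<in> L}"
proof -
  have "x \<in> \<sigma> ` {x \<in> A. card (orbit \<sigma> x) \<in> L}" if "x \<in> A" "card (orbit \<sigma> x) \<in> L" for x
  proof -
    have "x \<in> \<sigma> ` A"
      using that(1) by (simp only: assms(2))
    then obtain y where "y \<in> A" "x = \<sigma> y"
      by blast
    then show ?thesis
      using that(2) permutation_orbit_step[OF assms(1)] by simp
  qed
  moreover have "\<sigma> x \<in> A" if "x \<in> A" for x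
    using imageI[OF that, of \<sigma>] by (simp only: assms(2))
  ultimately show ?thesis
    using permutation_orbit_step[OF assms(1)] by auto
qed

text \<open>Induction on the set of lengths, splitting off one length at a time. The splitting is
  legitimate because roots preserve the length of the \<sigma>-cycle through a point.\<close>

lemma card_roots_on_lengths:
  assumes \<sigma>: "permutation \<sigma>" "\<sigma> ` A = A" "finite A" and "finite L"
  shows "card (roots_on m \<sigma> {x \<in> A. card (orbit \<sigma> x) \<in> L}) =
    (\<Prod>l\<in>L. card (roots_on m \<sigma> {x \<in> A. card (orbit \<sigma> x) = l}))"
  using \<open>finite L\<close>
proof (induction L)
  case empty
  then show ?case
    by (simp add: roots_on_empty)
next
  case (insert l L)
  let ?S = "{x \<in> A. card (orbit \<sigma> x) = l}" and ?T = "{x \<in> A. card (orbit \<sigma> x) \<in> L}"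
  have un: "{x \<in> A. card (orbit \<sigma> x) \<in> insert l L} = ?S \<union> ?T"
    by auto
  have "\<tau> ` ?S = ?S" if \<tau>: "\<tau> \<in> roots_on m \<sigma> (?S \<union> ?T)" for \<tau>
  \<comment> \<open>An injective map of a finite set into itself is onto, so only the inclusion has
    to be shown.\<close>
  proof (rule endo_inj_surj)
    have "\<sigma> ` (?S \<union> ?T) \<subseteq> ?S \<union> ?T"
      using image_lengths[OF \<sigma>(1,2), of "insert l L"] by (simp only: un order_refl)
    then have "card (orbit \<sigma> (\<tau> x)) = card (orbit \<sigma> x)" if "x \<in> ?S" for x
      using that by (intro card_orbit_root_image[OF \<sigma>(1) _ \<tau>]) auto
    moreover have "\<tau> x \<in> A" if "x \<in> ?S" for x
      using \<tau> that permutes_in_image[of \<tau> "?S \<union> ?T" x] by (auto simp: roots_on_def)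
    ultimately show "\<tau> ` ?S \<subseteq> ?S"
      by auto
    have "inj \<tau>"
      using \<tau> by (auto simp: roots_on_def permutes_inj)
    then show "inj_on \<tau> ?S"
      by (rule inj_on_subset) simp
  qed (use \<sigma>(3) in auto)
  moreover have "?S \<inter> ?T = {}"
    using insert.hyps(2) by auto
  ultimately show ?case
    by (simp only: un card_roots_on_union prod.insert[OF insert.hyps] insert.IH)
qed

section \<open>Assembling the formula for a given cycle type\<close>

lemma mth_roots_eq_roots_on:
  assumes "\<sigma> permutes {1..n}"
  shows "mth_roots m n \<sigma> = roots_on m \<sigma> {1..n}"
proof -
  \<comment> \<open>Outside \<open>{1..n}\<close> both sides fix \<open>x\<close>, so the equation
    of functions reduces to the pointwise one on \<open>{1..n}\<close>.\<close>
  have "(\<tau> ^^ m) x = \<sigma> x" if "\<tau> permutes {1..n}" "x \<notin> {1..n}" for \<tau> x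
  proof -
    have "(\<tau> ^^ k) x = x" for k
      using that by (induction k) (simp_all add: permutes_not_in)
    then show ?thesis
      using assms that(2) by (simp add: permutes_not_in)
  qed
  then show ?thesis
    by (auto simp: mth_roots_def roots_on_def fun_eq_iff)
qed

text \<open>Converts the number of cycles given by \<open>has_cycle_type\<close> into the number of
  points that the uniform count expects: the cycles of length \<open>l\<close> partition these
  points.\<close>

lemma card_points_of_cycle_length:
  assumes "\<sigma> permutes {1..n}"
  shows "card {x \<in> {1..n}. card (orbit \<sigma> x) = l} = card (cycles_of_length n \<sigma> l) * l"
proof -
  have \<sigma>: "permutation \<sigma>"
    using assms by (auto simp: permutation_permutes)
  have un: "\<Union> (cycles_of_length n \<sigma> l) = {x \<in> {1..n}. card (orbit \<sigma> x) = l}"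
  proof
    show "\<Union> (cycles_of_length n \<sigma> l) \<subseteq> {x \<in> {1..n}. card (orbit \<sigma> x) = l}"
    proof clarify
      fix y C assume "C \<in> cycles_of_length n \<sigma> l" "y \<in> C"
      then obtain x where x: "x \<in> {1..n}" "y \<in> orbit \<sigma> x" "card (orbit \<sigma> x) = l"
        by (auto simp: cycles_of_length_def)
      then show "y \<in> {1..n} \<and> card (orbit \<sigma> y) = l"
        using permutes_orbit_subset[OF assms x(1)] orbit_eq_if_in_orbit[OF \<sigma> x(2)] by auto
    qed
    show "{x \<in> {1..n}. card (orbit \<sigma> x) = l} \<subseteq> \<Union> (cycles_of_length n \<sigma> l)"
    proof
      fix x assume "x \<in> {x \<in> {1..n}. card (orbit \<sigma> x) = l}"
      then have "orbit \<sigma> x \<in> cycles_of_length n \<sigma> l"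
        by (simp add: cycles_of_length_def)
      then show "x \<in> \<Union> (cycles_of_length n \<sigma> l)"
        using permutation_self_in_orbit[OF \<sigma>, of x] by blast
    qed
  qed
  have "l * card (cycles_of_length n \<sigma> l) = card (\<Union> (cycles_of_length n \<sigma> l))"
  proof (rule card_partition)
    show "finite (\<Union> (cycles_of_length n \<sigma> l))"
      by (simp add: un)
    show "C \<inter> D = {}"
      if "C \<in> cycles_of_length n \<sigma> l" "D \<in> cycles_of_length n \<sigma> l" "C \<noteq> D" for C D
      using that orbit_eq_if_in_orbit[OF \<sigma>] by (auto simp: cycles_of_length_def) blast+
  qed (auto simp: cycles_of_length_def)
  then show ?thesis
    by (simp add: un mult.commute)
qed

theorem theorem1:
  fixes m n :: nat and \<sigma> a :: "nat \<Rightarrow> nat"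
  assumes "m \<ge> 1" and "n \<ge> 1"
    and "\<sigma> permutes {1..n}"
    and "has_cycle_type n \<sigma> a"
  shows "real (card (mth_roots m n \<sigma>)) =
    (\<Prod>l | l \<in> {1..n} \<and> a l \<noteq> 0.
       fact (a l) *
       (\<Sum>\<epsilon>\<in>\<E> m l (a l).
          \<Prod>i<card (G m l (a l)).
            real l ^ ((assoc_vec m l (a l) ! i - 1) * \<epsilon> ! i) /
            (real (assoc_vec m l (a l) ! i) ^ (\<epsilon> ! i) * fact (\<epsilon> ! i))))"
proof -
  have \<sigma>: "permutation \<sigma>" "\<sigma> ` {1..n} = {1..n}"
    using assms(3) by (auto simp: permutation_permutes permutes_image)
  let ?L = "{l. l \<in> {1..n} \<and> a l \<noteq> 0}"
  let ?S = "\<lambda>l. {x \<in> {1..n}. card (orbit \<sigma> x) = l}"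
  have card_S: "card (?S l) = a l * l" if "l \<in> ?L" for l
    using that assms(4) card_points_of_cycle_length[OF assms(3)] by (simp add: has_cycle_type_def)
  \<comment> \<open>The cycle of \<open>x\<close> itself witnesses that \<open>a\<close> is nonzero
    at its length, so the lengths in \<open>?L\<close> account for all points.\<close>
  have "card (orbit \<sigma> x) \<in> ?L" if x: "x \<in> {1..n}" for x
  proof -
    have "card (orbit \<sigma> x) \<le> n"
      using card_mono[OF _ permutes_orbit_subset[OF assms(3) x]] by simp
    moreover have pos: "0 < card (orbit \<sigma> x)"
      using \<sigma>(1) by (rule card_orbit_pos)
    moreover have "orbit \<sigma> x \<in> cycles_of_length n \<sigma> (card (orbit \<sigma> x))"
      using x by (simp add: cycles_of_length_def)
    moreover have "finite (cycles_of_length n \<sigma> (card (orbit \<sigma> x)))"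
      by (simp add: cycles_of_length_def)
    ultimately have "card (cycles_of_length n \<sigma> (card (orbit \<sigma> x))) \<noteq> 0"
      by auto
    then show ?thesis
      using assms(4) pos \<open>card (orbit \<sigma> x) \<le> n\<close> by (simp add: has_cycle_type_def)
  qed
  then have "{x \<in> {1..n}. card (orbit \<sigma> x) \<in> ?L} = {1..n}"
    by blast
  then have "card (mth_roots m n \<sigma>) = (\<Prod>l\<in>?L. card (roots_on m \<sigma> (?S l)))"
    using card_roots_on_lengths[OF \<sigma>, of ?L m] mth_roots_eq_roots_on[OF assms(3), of m] by simp
  then have "real (card (mth_roots m n \<sigma>)) = (\<Prod>l\<in>?L. real (card (roots_on m \<sigma> (?S l))))"
    by simp
  also have "\<dots> = (\<Prod>l\<in>?L. fact (a l) *
       (\<Sum>\<epsilon>\<in>\<E> m l (a l).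
          \<Prod>i<card (G m l (a l)).
            real l ^ ((assoc_vec m l (a l) ! i - 1) * \<epsilon> ! i) /
            (real (assoc_vec m l (a l) ! i) ^ (\<epsilon> ! i) * fact (\<epsilon> ! i))))"
  proof (rule prod.cong[OF refl])
    fix l assume l: "l \<in> ?L"
    let ?c = "\<lambda>g. real l ^ (g - 1) / real g"
    have "\<sigma> ` ?S l = ?S l"
      using image_lengths[OF \<sigma>, of "{l}"] by simp
    then have "real (card (roots_on m \<sigma> (?S l))) = fact (a l) * expsum (admissible m l) ?c (a l)"
      using l assms(1) card_S[OF l] by (intro card_roots_on_uniform[OF \<sigma>(1)]) auto
    \<comment> \<open>The recursion is finished, so the index set can be cut down to the one in the
      statement.\<close>
    also have "expsum (admissible m l) ?c (a l) = expsum (G m l (a l)) ?c (a l)"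
      using assms(1) by (subst expsum_restrict) (simp_all add: finite_admissible G_eq_admissible)
    also have "\<dots> = (\<Sum>\<epsilon>\<in>\<E> m l (a l). \<Prod>i<card (G m l (a l)).
        ?c (assoc_vec m l (a l) ! i) ^ (\<epsilon> ! i) / fact (\<epsilon> ! i))"
      by (simp only: expsum_eq_sum_lists[OF finite_G] \<E>_def assoc_vec_def)
    finally show "real (card (roots_on m \<sigma> (?S l))) = fact (a l) *
       (\<Sum>\<epsilon>\<in>\<E> m l (a l).
          \<Prod>i<card (G m l (a l)).
            real l ^ ((assoc_vec m l (a l) ! i - 1) * \<epsilon> ! i) /
            (real (assoc_vec m l (a l) ! i) ^ (\<epsilon> ! i) * fact (\<epsilon> ! i)))"
      by (simp add: power_divide power_mult)
  qed
  finally show ?thesis .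
qed

end
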